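(* Let $\mathcal A_0$ be a central arrangement of hyperplanes in $\mathbb C^{r_0}$ and $\mathcal A_1$ a central arrangement of hyperplanes in $\mathbb C^{r_1}$. Choose a hyperplane of each to be identified, and choose linear coordinates $x=(x_1,\dots,x_{r_0})$ on $\mathbb C^{r_0}$ and $(x_1,y_2,\dots,y_{r_1})$ on $\mathbb C^{r_1}$ so that the chosen hyperplanes are both $\{x_1=0\}$; write the defining polynomials as $Q_0(x_1,\dots,x_{r_0})$ and $Q_1=x_1\hat Q_1(x_1,y_2,\dots,y_{r_1})$. Let $P(\mathcal A_0,\mathcal A_1)$ be the arrangement in $\mathbb C^{r_0+r_1-1}$ (coordinates $x_1,\dots,x_{r_0},y_2,\dots,y_{r_1}$) with defining polynomial $Q_0(x_1,\dots,x_{r_0})\hat Q_1(x_1,y_2,\dots,y_{r_1})$. Let $\mathcal S$ be the arrangement in $\mathbb C^1$ with defining polynomial $x$. Then the complements $C(\mathcal A_0\oplus\mathcal A_1)$ and $C(\mathcal S\oplus P(\mathcal A_0,\mathcal A_1))$ are diffeomorphic.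
   Context: An arrangement $\mathcal A=\{H_1,\dots,H_n\}$ of affine hyperplanes in $\mathbb C^r$, $H_i=\{\phi_i=0\}$ with $\phi_i$ a degree-one polynomial, has defining polynomial $Q(\mathcal A)=\prod_i\phi_i$; it is central if all $\phi_i$ are homogeneous linear forms. The complement is $C(\mathcal A)=\mathbb C^r\setminus\bigcup_i H_i$. If $\mathcal A_0,\mathcal A_1$ have defining polynomials $Q_0(x)$, $Q_1(y)$ in disjoint sets of variables $x=(x_1,\dots,x_{r_0})$, $y=(y_1,\dots,y_{r_1})$, the direct sum $\mathcal A_0\oplus\mathcal A_1$ is the arrangement in $\mathbb C^{r_0+r_1}$ with defining polynomial $Q_0(x)Q_1(y)$. *)

theory Defs
  imports "HOL-Analysis.Analysis" "HOL-Library.Poly_Mapping"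
begin

section \<open>Polynomials on \<open>\<complex>\<^sup>r\<close>\<close>

text \<open>
  Affine space \<open>\<complex>\<^sup>r\<close> is \<^typ>\<open>complex ^ 'n\<close> with \<open>r = CARD('n)\<close>.  A polynomial with variables indexed
  by \<^typ>\<open>'n\<close> is a finitely supported map from monomials (finitely supported exponent maps) to
  coefficients; the ring structure (convolution product) is the one of \<^theory>\<open>HOL-Library.Poly_Mapping\<close>.
\<close>

type_synonym 'n cpoly = "('n \<Rightarrow>\<^sub>0 nat) \<Rightarrow>\<^sub>0 complex"

definition Const :: "complex \<Rightarrow> 'n cpoly" where
  "Const c = Poly_Mapping.single 0 c"

definition Var :: "'n \<Rightarrow> 'n cpoly" where
  "Var i = Poly_Mapping.single (Poly_Mapping.single i 1) 1"

definition mono_degree :: "('n \<Rightarrow>\<^sub>0 nat) \<Rightarrow> nat" where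
  "mono_degree m = (\<Sum>i\<in>Poly_Mapping.keys m. Poly_Mapping.lookup m i)"

text \<open>The total degree, with value 0 for the zero polynomial.\<close>

definition total_degree :: "'n cpoly \<Rightarrow> nat" where
  "total_degree p = Max (insert 0 (mono_degree ` Poly_Mapping.keys p))"

definition linear_form :: "'n cpoly \<Rightarrow> bool" where
  "linear_form p \<longleftrightarrow> p \<noteq> 0 \<and> (\<forall>m\<in>Poly_Mapping.keys p. mono_degree m = 1)"

text \<open>
  Substitution of \<open>v i\<close> for the \<open>i\<close>-th variable, coefficients being mapped to the target ring by \<open>h\<close>.
\<close>

definition substitute :: "(complex \<Rightarrow> 'r::comm_ring_1) \<Rightarrow> ('n \<Rightarrow> 'r) \<Rightarrow> 'n cpoly \<Rightarrow> 'r" where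
  "substitute h v p =
     (\<Sum>m\<in>Poly_Mapping.keys p. h (Poly_Mapping.lookup p m) *
        (\<Prod>i\<in>Poly_Mapping.keys m. v i ^ Poly_Mapping.lookup m i))"

definition evaluate :: "'n cpoly \<Rightarrow> complex ^ 'n \<Rightarrow> complex" where
  "evaluate p x = substitute (\<lambda>c. c) (\<lambda>i. x $ i) p"

definition rename_vars :: "('n \<Rightarrow> 'k) \<Rightarrow> 'n cpoly \<Rightarrow> 'k cpoly" where
  "rename_vars f p = substitute Const (\<lambda>i. Var (f i)) p"

definition zero_locus :: "'n cpoly \<Rightarrow> (complex ^ 'n) set" where
  "zero_locus p = {x. evaluate p x = 0}"


section \<open>Hyperplane arrangements\<close>

definition arrangement :: "(complex ^ 'n) set set \<Rightarrow> bool" where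
  "arrangement \<A> \<longleftrightarrow>
     finite \<A> \<and> (\<forall>H\<in>\<A>. \<exists>\<phi>. total_degree \<phi> = 1 \<and> H = zero_locus \<phi>)"

definition central_arrangement :: "(complex ^ 'n) set set \<Rightarrow> bool" where
  "central_arrangement \<A> \<longleftrightarrow>
     arrangement \<A> \<and> (\<forall>H\<in>\<A>. \<exists>\<phi>. linear_form \<phi> \<and> H = zero_locus \<phi>)"

text \<open>
  \<open>Q\<close> is a defining polynomial of \<open>\<A>\<close>.  This is a relation: the \<open>\<phi> H\<close>, and hence \<open>Q\<close>, are only
  determined up to nonzero scalars.
\<close>

definition defining_polynomial :: "(complex ^ 'n) set set \<Rightarrow> 'n cpoly \<Rightarrow> bool" where
  "defining_polynomial \<A> Q \<longleftrightarrow>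
     finite \<A> \<and>
     (\<exists>\<phi>. (\<forall>H\<in>\<A>. total_degree (\<phi> H) = 1 \<and> H = zero_locus (\<phi> H)) \<and> Q = (\<Prod>H\<in>\<A>. \<phi> H))"

definition complement :: "(complex ^ 'n) set set \<Rightarrow> (complex ^ 'n) set" where
  "complement \<A> = UNIV - \<Union>\<A>"

text \<open>
  \<open>\<B>\<close> is the direct sum of \<open>\<A>\<^sub>0\<close> and \<open>\<A>\<^sub>1\<close>: its defining polynomial is \<open>Q\<^sub>0(x) Q\<^sub>1(y)\<close>.
  The disjoint sets of variables are the two summands of the index type \<^typ>\<open>'m + 'n\<close>.
\<close>

definition is_direct_sum ::
    "(complex ^ 'm) set set \<Rightarrow> (complex ^ 'n) set set \<Rightarrow> (complex ^ ('m + 'n)) set set \<Rightarrow> bool" where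
  "is_direct_sum \<A>\<^sub>0 \<A>\<^sub>1 \<B> \<longleftrightarrow>
     (\<exists>Q\<^sub>0 Q\<^sub>1. defining_polynomial \<A>\<^sub>0 Q\<^sub>0 \<and> defining_polynomial \<A>\<^sub>1 Q\<^sub>1 \<and>
        defining_polynomial \<B> (rename_vars Inl Q\<^sub>0 * rename_vars Inr Q\<^sub>1))"

text \<open>
  The index type \<^typ>\<open>'p\<close> is the union of copies of \<^typ>\<open>'m\<close> and \<^typ>\<open>'n\<close> that share exactly the index
  \<open>f a = g b\<close>, so that \<open>CARD('p) = CARD('m) + CARD('n) - 1\<close>.  With \<open>x\<^sub>1\<close> the variable of index \<open>a\<close>
  (identified with \<open>b\<close>), \<open>f\<close> lists the indices of \<open>x\<^sub>1, \<dots>, x\<^sub>r\<^sub>0\<close> and \<open>g\<close> those of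
  \<open>x\<^sub>1, y\<^sub>2, \<dots>, y\<^sub>r\<^sub>1\<close>.
\<close>

definition glued_indices :: "'m \<Rightarrow> 'n \<Rightarrow> ('m \<Rightarrow> 'p) \<Rightarrow> ('n \<Rightarrow> 'p) \<Rightarrow> bool" where
  "glued_indices a b f g \<longleftrightarrow>
     inj f \<and> inj g \<and> f a = g b \<and> range f \<inter> range g = {f a} \<and> range f \<union> range g = UNIV"


section \<open>Diffeomorphisms between open sets\<close>

text \<open>
  Continuous differentiability of order \<open>k\<close> in the real sense, by iterated directional derivatives.
  The notions of this section are meant for open subsets of finite-dimensional spaces.
\<close>

primrec k_smooth_on :: "nat \<Rightarrow> 'a::euclidean_space set \<Rightarrow> ('a \<Rightarrow> 'b::euclidean_space) \<Rightarrow> bool" where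
  "k_smooth_on 0 U f \<longleftrightarrow> continuous_on U f"
| "k_smooth_on (Suc k) U f \<longleftrightarrow>
     (\<forall>x\<in>U. f differentiable (at x)) \<and>
     (\<forall>v. k_smooth_on k U (\<lambda>x. frechet_derivative f (at x) v))"

definition smooth_on :: "'a::euclidean_space set \<Rightarrow> ('a \<Rightarrow> 'b::euclidean_space) \<Rightarrow> bool" where
  "smooth_on U f \<longleftrightarrow> (\<forall>k. k_smooth_on k U f)"

definition diffeomorphic :: "'a::euclidean_space set \<Rightarrow> 'b::euclidean_space set \<Rightarrow> bool" where
  "diffeomorphic U V \<longleftrightarrow>
     open U \<and> open V \<and>
     (\<exists>f g. smooth_on U f \<and> smooth_on V g \<and> f ` U \<subseteq> V \<and> g ` V \<subseteq> U \<and>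
        (\<forall>x\<in>U. g (f x) = x) \<and> (\<forall>y\<in>V. f (g y) = y))"

end

theory Submission
  imports Defs
begin

text \<open>
  After the linear changes of coordinates, the complement of \<open>\<A>\<^sub>0 \<oplus> \<A>\<^sub>1\<close> consists of the pairs
  \<open>(x, y)\<close> with \<open>Q\<^sub>0 x \<noteq> 0\<close>, \<open>y\<^sub>b \<noteq> 0\<close> and \<open>Qhat\<^sub>1 y \<noteq> 0\<close>, and there \<open>x\<^sub>a \<noteq> 0\<close> because
  \<open>{x\<^sub>a = 0}\<close> is one of the hyperplanes.  Since \<open>\<A>\<^sub>1\<close> is central, rescaling \<open>y\<close> by \<open>x\<^sub>a / y\<^sub>b\<close> preserves
  the conditions on \<open>y\<close> and makes its \<open>b\<close>-th coordinate equal to \<open>x\<^sub>a\<close>, so that \<open>x\<close> and the rescaled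
  \<open>y\<close> glue to a point \<open>p\<close> of the complement of \<open>\<P>\<close>.  Remembering \<open>s = y\<^sub>b\<close> makes the map
  \<open>(x, y) \<mapsto> (s, p)\<close> invertible: \<open>y\<close> is recovered from \<open>p\<close> on scaling by \<open>s / p\<^sub>a\<close>.  Both maps are
  rational with denominators that do not vanish.
\<close>

section \<open>Evaluation of polynomials\<close>

text \<open>The product runs over all indices, those outside the support contributing 1, so
  additivity in \<open>m\<close> needs no comparison of supports.\<close>

definition monomial_value :: "('n \<Rightarrow>\<^sub>0 nat) \<Rightarrow> complex ^ 'n \<Rightarrow> complex" where
  "monomial_value m x = (\<Prod>i\<in>UNIV. (x $ i) ^ Poly_Mapping.lookup m i)"

lemma monomial_value_keys:
  fixes x :: "complex ^ 'n"
  shows "(\<Prod>i\<in>Poly_Mapping.keys m. (x $ i) ^ Poly_Mapping.lookup m i) = monomial_value m x"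
  unfolding monomial_value_def
  by (rule prod.mono_neutral_left) (auto simp: in_keys_iff)

lemma monomial_value_add:
  "monomial_value (m + m') x = monomial_value m x * monomial_value m' x"
  by (simp add: monomial_value_def lookup_add power_add prod.distrib)

lemma monomial_value_zero [simp]: "monomial_value 0 x = 1"
  by (simp add: monomial_value_def)

lemma monomial_value_single [simp]: "monomial_value (Poly_Mapping.single i 1) x = x $ i"
proof -
  have "monomial_value (Poly_Mapping.single i 1) x = (\<Prod>j\<in>UNIV. if j = i then x $ j else 1)"
    unfolding monomial_value_def by (intro prod.cong) (auto simp: lookup_single when_def)
  then show ?thesis by simp
qed

lemma monomial_value_scale:
  fixes x :: "complex ^ 'n"
  shows "monomial_value m (c *s x) = c ^ mono_degree m * monomial_value m x"
proof -
  have "mono_degree m = (\<Sum>i\<in>UNIV. Poly_Mapping.lookup m i)"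
    unfolding mono_degree_def by (rule sum.mono_neutral_left) (auto simp: in_keys_iff)
  then show ?thesis
    by (simp add: monomial_value_def power_mult_distrib prod.distrib power_sum)
qed

text \<open>Cancellation may shrink the support of a sum; a common superset \<open>K\<close> puts
  the summands and the sum over one index set.\<close>

lemma evaluate_superset:
  fixes x :: "complex ^ 'n"
  assumes "finite K" "Poly_Mapping.keys p \<subseteq> K"
  shows "evaluate p x = (\<Sum>m\<in>K. Poly_Mapping.lookup p m * monomial_value m x)"
  unfolding evaluate_def substitute_def monomial_value_keys
  by (rule sum.mono_neutral_left) (use assms in \<open>auto simp: in_keys_iff\<close>)

lemma evaluate_0 [simp]: "evaluate 0 x = 0"
  by (simp add: evaluate_def substitute_def)

lemma evaluate_add:
  fixes x :: "complex ^ 'n"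
  shows "evaluate (p + q) x = evaluate p x + evaluate q x"
proof -
  let ?K = "Poly_Mapping.keys p \<union> Poly_Mapping.keys q"
  have "Poly_Mapping.keys (p + q) \<subseteq> ?K"
    by (rule keys_add)
  then show ?thesis
    by (simp add: evaluate_superset[of ?K] lookup_add sum.distrib distrib_right)
qed

lemma evaluate_single:
  fixes x :: "complex ^ 'n"
  shows "evaluate (Poly_Mapping.single m c) x = c * monomial_value m x"
  by (subst evaluate_superset[of "{m}"]) auto

text \<open>Updating at a fresh key is adding a single term, which turns
  \<open>update_induct\<close> into an induction along sums.\<close>

lemma poly_mapping_single_add_induct [case_names zero add]:
  assumes "P 0"
    and step: "\<And>m c p. P p \<Longrightarrow> P (Poly_Mapping.single m c + p)"
  shows "P (p :: 'a \<Rightarrow>\<^sub>0 'b::comm_monoid_add)"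
proof (induction p rule: update_induct)
  case (update p m c)
  have "Poly_Mapping.update m c p = Poly_Mapping.single m c + p"
    using update.hyps(1)
    by (intro poly_mapping_eqI) (auto simp: lookup_update lookup_add lookup_single when_def in_keys_iff)
  then show ?case
    using step[OF update.IH] by simp
qed (rule assms(1))

text \<open>Additivity in \<open>q\<close> reduces this to a product of two single terms, whose
  exponents add; \<open>evaluate_mult\<close> repeats the argument in \<open>p\<close>.\<close>

lemma evaluate_mult_single:
  "evaluate (Poly_Mapping.single m c * q) x = c * monomial_value m x * evaluate q x"
  by (induction q rule: poly_mapping_single_add_induct)
     (simp_all add: distrib_left evaluate_add mult_single evaluate_single monomial_value_add)

lemma evaluate_mult: "evaluate (p * q) x = evaluate p x * evaluate q x"
  by (induction p rule: poly_mapping_single_add_induct)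
     (simp_all add: distrib_right evaluate_add evaluate_mult_single evaluate_single)

lemma evaluate_Const [simp]: "evaluate (Const c) x = c"
  by (simp add: Const_def evaluate_single)

lemma evaluate_Var [simp]: "evaluate (Var i) x = x $ i"
  by (simp only: Var_def evaluate_single monomial_value_single) simp

lemma evaluate_1 [simp]: "evaluate 1 x = 1"
  using evaluate_Const[of 1 x] by (simp add: Const_def)

lemma evaluate_sum: "evaluate (sum p A) x = (\<Sum>i\<in>A. evaluate (p i) x)"
  by (induction A rule: infinite_finite_induct) (simp_all add: evaluate_add)

lemma evaluate_prod: "evaluate (prod p A) x = (\<Prod>i\<in>A. evaluate (p i) x)"
  by (induction A rule: infinite_finite_induct) (simp_all add: evaluate_mult)

lemma evaluate_power: "evaluate (p ^ n) x = evaluate p x ^ n"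
  by (induction n) (simp_all add: evaluate_mult)

lemma evaluate_rename_vars: "evaluate (rename_vars f p) x = evaluate p (\<chi> i. x $ f i)"
  by (simp add: rename_vars_def substitute_def evaluate_sum evaluate_prod evaluate_mult
      evaluate_power) (simp add: evaluate_def substitute_def)

lemma continuous_on_evaluate:
  fixes p :: "('n::finite) cpoly"
  shows "continuous_on S (evaluate p)"
  unfolding evaluate_def substitute_def by (intro continuous_intros)

lemma evaluate_linear_form_scale:
  fixes x :: "complex ^ 'n"
  assumes "linear_form p"
  shows "evaluate p (c *s x) = c * evaluate p x"
  using assms unfolding linear_form_def
  by (simp add: evaluate_superset[OF finite_keys order_refl] monomial_value_scale sum_distrib_left
      mult_ac)


section \<open>Complements of arrangements\<close>

text \<open>A finite product of complex numbers vanishes exactly when a factor does, so the scalar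
  ambiguity of \<open>Q\<close> is harmless.\<close>

lemma complement_eq_nonzero:
  assumes "defining_polynomial \<A> Q"
  shows "complement \<A> = {x. evaluate Q x \<noteq> 0}"
proof -
  obtain \<phi> where fin: "finite \<A>" and zl: "\<And>H. H \<in> \<A> \<Longrightarrow> H = zero_locus (\<phi> H)"
    and Q: "Q = (\<Prod>H\<in>\<A>. \<phi> H)"
    using assms unfolding defining_polynomial_def by blast
  have mem: "x \<in> H \<longleftrightarrow> evaluate (\<phi> H) x = 0" if "H \<in> \<A>" for H x
    by (subst zl[OF that]) (simp add: zero_locus_def)
  have "x \<in> complement \<A> \<longleftrightarrow> (\<forall>H\<in>\<A>. evaluate (\<phi> H) x \<noteq> 0)" for x
    unfolding complement_def using mem by blast
  moreover have "evaluate Q x \<noteq> 0 \<longleftrightarrow> (\<forall>H\<in>\<A>. evaluate (\<phi> H) x \<noteq> 0)" for x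
    by (simp add: Q evaluate_prod fin)
  ultimately show ?thesis
    by blast
qed

lemma open_complement:
  fixes \<A> :: "(complex ^ 'n) set set"
  assumes "defining_polynomial \<A> Q"
  shows "open (complement \<A>)"
  unfolding complement_eq_nonzero[OF assms]
  by (rule open_Collect_neq[OF continuous_on_evaluate continuous_on_const])

text \<open>Passing back from the witnessing polynomials to complements removes any dependence on
  their choice.\<close>

lemma complement_direct_sum:
  assumes "is_direct_sum \<A> \<B> \<D>"
  shows "z \<in> complement \<D> \<longleftrightarrow>
    (\<chi> i. z $ Inl i) \<in> complement \<A> \<and> (\<chi> j. z $ Inr j) \<in> complement \<B>"
proof -
  obtain P Q where PQ: "defining_polynomial \<A> P" "defining_polynomial \<B> Q"
    "defining_polynomial \<D> (rename_vars Inl P * rename_vars Inr Q)"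
    using assms unfolding is_direct_sum_def by blast
  show ?thesis
    unfolding PQ[THEN complement_eq_nonzero] by (simp add: evaluate_mult evaluate_rename_vars)
qed

lemma open_complement_direct_sum: "is_direct_sum \<A> \<B> \<D> \<Longrightarrow> open (complement \<D>)"
  by (auto simp: is_direct_sum_def dest: open_complement)

lemma complement_image:
  "inj h \<Longrightarrow> h x \<in> complement ((`) h ` \<A>) \<longleftrightarrow> x \<in> complement \<A>"
  by (simp add: complement_def inj_image_mem_iff)

text \<open>Scaling the point multiplies each linear form by \<open>c\<close>, so every hyperplane
  is invariant. Centrality enters the argument here.\<close>

lemma central_complement_scale:
  fixes \<A> :: "(complex ^ 'n) set set"
  assumes "central_arrangement \<A>" and "c \<noteq> 0"
  shows "c *s x \<in> complement \<A> \<longleftrightarrow> x \<in> complement \<A>"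
proof -
  have "c *s x \<notin> H \<longleftrightarrow> x \<notin> H" if H: "H \<in> \<A>" for H
  proof -
    have "\<exists>\<phi>. linear_form \<phi> \<and> H = zero_locus \<phi>"
      using assms(1) H by (simp only: central_arrangement_def)
    then obtain \<phi> where \<phi>: "linear_form \<phi>" "H = zero_locus \<phi>"
      by (elim exE conjE)
    show ?thesis
      unfolding \<phi>(2) using assms(2)
      by (simp add: zero_locus_def evaluate_linear_form_scale[OF \<phi>(1)])
  qed
  then have "(\<forall>H\<in>\<A>. c *s x \<notin> H) \<longleftrightarrow> (\<forall>H\<in>\<A>. x \<notin> H)"
    by (rule ball_cong[OF refl])
  then show ?thesis
    by (simp add: complement_def)
qed


section \<open>Smooth maps\<close>

text \<open>On an open set a derivative depends only on nearby values, so agreement on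
  \<open>U\<close> passes to all directional derivatives.\<close>

lemma k_smooth_on_cong:
  assumes "open U" "\<And>x. x \<in> U \<Longrightarrow> f x = g x"
  shows "k_smooth_on k U f \<longleftrightarrow> k_smooth_on k U g"
  using assms(2)
proof (induction k arbitrary: f g)
  case 0
  then show ?case by (simp cong: continuous_on_cong)
next
  case (Suc k)
  have diff: "f differentiable (at x) \<longleftrightarrow> g differentiable (at x)" if "x \<in> U" for x
    unfolding differentiable_def
    using has_derivative_transform_within_open[OF _ assms(1) that, of f _ UNIV g]
      has_derivative_transform_within_open[OF _ assms(1) that, of g _ UNIV f] Suc.prems
    by fastforce
  have deriv: "frechet_derivative f (at x) = frechet_derivative g (at x)"
    if "x \<in> U" "f differentiable (at x)" for x
    using frechet_derivative_transform_within_open[OF that(2) assms(1) that(1)] Suc.prems by blast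
  have "k_smooth_on k U (\<lambda>x. frechet_derivative f (at x) v) \<longleftrightarrow>
      k_smooth_on k U (\<lambda>x. frechet_derivative g (at x) v)"
    if "\<forall>x\<in>U. f differentiable (at x)" for v
    using that by (intro Suc.IH) (simp add: deriv)
  then show ?case
    using diff by auto
qed

text \<open>Lets the closure rules below work with an explicit derivative formula in place of
  \<open>frechet_derivative\<close>.\<close>

lemma k_smooth_on_SucI:
  assumes "open U"
    and f': "\<And>x. x \<in> U \<Longrightarrow> (f has_derivative f' x) (at x)"
    and "\<And>v. k_smooth_on k U (\<lambda>x. f' x v)"
  shows "k_smooth_on (Suc k) U f"
proof -
  have "frechet_derivative f (at x) = f' x" if "x \<in> U" for x
    using frechet_derivative_at[OF f'[OF that]] by simp
  then have "k_smooth_on k U (\<lambda>x. frechet_derivative f (at x) v) = k_smooth_on k U (\<lambda>x. f' x v)" for v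
    by (intro k_smooth_on_cong assms(1)) simp
  then show ?thesis
    using assms(3) f' by (auto simp: differentiable_def)
qed

text \<open>At the bottom, differentiability gives continuity; above it, the induction hypothesis
  applies to the directional derivatives.\<close>

lemma k_smooth_on_SucD:
  assumes "k_smooth_on (Suc k) U f"
  shows "k_smooth_on k U f"
  using assms
proof (induction k arbitrary: f)
  case 0
  then show ?case
    by (auto intro!: continuous_at_imp_continuous_on differentiable_imp_continuous_within)
next
  case (Suc k)
  then show ?case
    by (simp only: k_smooth_on.simps(2)) blast
qed

lemma k_smooth_on_Suc_has_derivative:
  assumes "k_smooth_on (Suc k) U f" "x \<in> U"
  shows "(f has_derivative frechet_derivative f (at x)) (at x)"
  using assms frechet_derivative_works by auto

lemma k_smooth_on_const: "k_smooth_on k U (\<lambda>_. c)"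
  by (induction k arbitrary: c) (simp_all add: continuous_on_const)

text \<open>Such a map is its own derivative at every point, so its directional derivatives are
  constant.\<close>

lemma smooth_on_bounded_linear:
  assumes "bounded_linear f"
  shows "smooth_on U f"
proof -
  have "frechet_derivative f (at x) = f" for x
    using frechet_derivative_at[OF bounded_linear.has_derivative[OF assms has_derivative_ident]]
    by simp
  then have "k_smooth_on k U f" for k
    using assms
    by (cases k) (auto intro: linear_continuous_on bounded_linear_imp_differentiable k_smooth_on_const)
  then show ?thesis
    by (simp add: smooth_on_def)
qed

lemma k_smooth_on_add:
  assumes "open U" "k_smooth_on k U f" "k_smooth_on k U g"
  shows "k_smooth_on k U (\<lambda>x. f x + g x)"
  using assms(2,3)
proof (induction k arbitrary: f g)
  case 0
  then show ?case by (simp add: continuous_on_add)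
next
  case (Suc k)
  show ?case
    by (rule k_smooth_on_SucI[OF assms(1) has_derivative_add])
       (use Suc in \<open>auto intro: k_smooth_on_Suc_has_derivative\<close>)
qed

lemma k_smooth_on_mult:
  fixes f g :: "'a::euclidean_space \<Rightarrow> complex"
  assumes "open U" "k_smooth_on k U f" "k_smooth_on k U g"
  shows "k_smooth_on k U (\<lambda>x. f x * g x)"
  using assms(2,3)
proof (induction k arbitrary: f g)
  case 0
  then show ?case by (simp add: continuous_on_mult)
next
  case (Suc k)
  let ?f' = "\<lambda>x. frechet_derivative f (at x)" and ?g' = "\<lambda>x. frechet_derivative g (at x)"
  \<comment> \<open>The Leibniz formula contains \<open>f\<close> and \<open>g\<close> themselves,
    which are therefore lowered to level \<open>k\<close>.\<close>
  have "k_smooth_on k U (\<lambda>x. f x * ?g' x v + ?f' x v * g x)" for v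
    by (intro k_smooth_on_add assms(1) Suc.IH k_smooth_on_SucD[OF Suc.prems(1)]
        k_smooth_on_SucD[OF Suc.prems(2)]) (use Suc.prems in auto)
  then show ?case
    by (intro k_smooth_on_SucI[OF assms(1) has_derivative_mult])
       (use Suc.prems in \<open>auto intro: k_smooth_on_Suc_has_derivative\<close>)
qed

text \<open>The derivative is a product of \<open>f'\<close> and two copies of
  \<open>inverse (f x)\<close>, which the induction hypothesis controls at level
  \<open>k\<close>.\<close>

lemma k_smooth_on_inverse:
  fixes f :: "'a::euclidean_space \<Rightarrow> complex"
  assumes "open U" "\<And>x. x \<in> U \<Longrightarrow> f x \<noteq> 0" "k_smooth_on k U f"
  shows "k_smooth_on k U (\<lambda>x. inverse (f x))"
  using assms(3)
proof (induction k)
  case 0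
  then show ?case using assms(2) by (simp add: continuous_on_inverse)
next
  case (Suc k)
  let ?f' = "\<lambda>x. frechet_derivative f (at x)"
  have inv: "k_smooth_on k U (\<lambda>x. inverse (f x))"
    by (rule Suc.IH[OF k_smooth_on_SucD[OF Suc.prems]])
  \<comment> \<open>Negation appears as the constant factor \<open>- 1\<close>, so the product rule
    covers it.\<close>
  have "k_smooth_on k U (\<lambda>x. - 1 * (inverse (f x) * ?f' x v * inverse (f x)))" for v
    by (intro k_smooth_on_mult assms(1) inv k_smooth_on_const) (use Suc.prems in auto)
  then have deriv: "k_smooth_on k U (\<lambda>x. - (inverse (f x) * ?f' x v * inverse (f x)))" for v
    by simp
  show ?case
    by (rule k_smooth_on_SucI[OF assms(1) _ deriv],
        rule Deriv.has_derivative_inverse)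
       (erule assms(2), erule k_smooth_on_Suc_has_derivative[OF Suc.prems])
qed

text \<open>The sum of the operator norms bounds the candidate derivative, and the remainder
  quotient tends to 0 in each component.\<close>

lemma has_derivative_vec_lambda:
  fixes f :: "'i::finite \<Rightarrow> 'a::real_normed_vector \<Rightarrow> 'b::real_normed_vector"
  assumes "\<And>i. (f i has_derivative f' i) F"
  shows "((\<lambda>x. \<chi> i. f i x) has_derivative (\<lambda>h. \<chi> i. f' i h)) F"
proof -
  have "bounded_linear (\<lambda>h. \<chi> i. f' i h)"
  proof (rule bounded_linear_intro)
    have lin: "bounded_linear (f' i)" for i
      using assms by (rule has_derivative_bounded_linear)
    show "(\<chi> i. f' i (x + y)) = (\<chi> i. f' i x) + (\<chi> i. f' i y)" for x y
      by (simp add: vec_eq_iff linear_add[OF bounded_linear.linear[OF lin]])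
    show "(\<chi> i. f' i (r *\<^sub>R x)) = r *\<^sub>R (\<chi> i. f' i x)" for r x
      by (simp add: vec_eq_iff linear_cmul[OF bounded_linear.linear[OF lin]])
    show "norm (\<chi> i. f' i x) \<le> norm x * (\<Sum>i\<in>UNIV. onorm (f' i))" for x
    proof -
      have "norm (\<chi> i. f' i x) \<le> (\<Sum>i\<in>UNIV. norm (f' i x))"
        by (simp add: norm_vec_def L2_set_le_sum)
      also have "\<dots> \<le> norm x * (\<Sum>i\<in>UNIV. onorm (f' i))"
        unfolding sum_distrib_left by (intro sum_mono) (metis onorm[OF lin] mult.commute)
      finally show ?thesis .
    qed
  qed
  moreover have "(\<lambda>y. inverse (norm (y - a)) *\<^sub>R
      ((\<chi> i. f i y) - (\<chi> i. f i a) - (\<chi> i. f' i (y - a)))) =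
    (\<lambda>y. \<chi> i. inverse (norm (y - a)) *\<^sub>R (f i y - f i a - f' i (y - a)))" for a
    by (simp add: fun_eq_iff vec_eq_iff)
  ultimately show ?thesis
    using assms unfolding has_derivative_def divideR_right
    by (auto intro!: vec_tendstoI)
qed

lemma k_smooth_on_vec_lambda:
  fixes f :: "'i::finite \<Rightarrow> 'a::euclidean_space \<Rightarrow> 'b::euclidean_space"
  assumes "open U" "\<And>i. k_smooth_on k U (f i)"
  shows "k_smooth_on k U (\<lambda>x. \<chi> i. f i x)"
  using assms(2)
proof (induction k arbitrary: f)
  case 0
  then show ?case by (simp add: continuous_on_vec_lambda)
next
  case (Suc k)
  have deriv: "k_smooth_on k U (\<lambda>x. \<chi> i. frechet_derivative (f i) (at x) v)" for v
    using Suc.prems by (intro Suc.IH) simp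
  show ?case
    by (rule k_smooth_on_SucI[OF assms(1) _ deriv], rule has_derivative_vec_lambda)
       (rule k_smooth_on_Suc_has_derivative[OF Suc.prems])
qed

lemma smooth_on_mult:
  fixes f g :: "'a::euclidean_space \<Rightarrow> complex"
  assumes "open U" "smooth_on U f" "smooth_on U g"
  shows "smooth_on U (\<lambda>x. f x * g x)"
  using assms by (simp add: smooth_on_def k_smooth_on_mult)

lemma smooth_on_divide:
  fixes f g :: "'a::euclidean_space \<Rightarrow> complex"
  assumes "open U" "\<And>x. x \<in> U \<Longrightarrow> g x \<noteq> 0" "smooth_on U f" "smooth_on U g"
  shows "smooth_on U (\<lambda>x. f x / g x)"
  using assms by (simp add: smooth_on_def divide_inverse k_smooth_on_mult k_smooth_on_inverse)

lemma smooth_on_vec_lambda: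
  fixes f :: "'i::finite \<Rightarrow> 'a::euclidean_space \<Rightarrow> 'b::euclidean_space"
  assumes "open U" "\<And>i. smooth_on U (f i)"
  shows "smooth_on U (\<lambda>x. \<chi> i. f i x)"
  using assms by (simp add: smooth_on_def k_smooth_on_vec_lambda)

lemma smooth_on_nth: "smooth_on U (\<lambda>x. x $ i)"
  by (intro smooth_on_bounded_linear bounded_linear_vec_nth)

text \<open>Serves both maps of the theorem: \<open>h\<close> is \<open>Inl\<close> or
  \<open>Inr\<close> on the direct sum, and \<open>Inr\<close> after \<open>f\<close> or
  \<open>g\<close> on the glued space.\<close>

lemma smooth_on_matrix_nth:
  fixes A :: "complex ^ 'n ^ 'k"
    and U :: "(complex ^ 'l) set"
  shows "smooth_on U (\<lambda>x. (A *v (\<chi> j. x $ h j)) $ i)"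
proof -
  have "bounded_linear (\<lambda>x::complex ^ 'l. \<chi> j::'n. x $ h j)"
    by (intro linear_conv_bounded_linear[THEN iffD1] linearI) (simp_all add: vec_eq_iff)
  then show ?thesis
    by (intro smooth_on_bounded_linear bounded_linear_compose[OF bounded_linear_vec_nth]
        bounded_linear_compose[OF matrix_vector_mul_bounded_linear])
qed


section \<open>The parallel connection\<close>

theorem theorem1p3:
  fixes \<A>\<^sub>0 :: "(complex ^ 'm) set set" and \<A>\<^sub>1 :: "(complex ^ 'n) set set"
    and H\<^sub>0 :: "(complex ^ 'm) set" and H\<^sub>1 :: "(complex ^ 'n) set"
    and T\<^sub>0 :: "complex ^ 'm ^ 'm" and T\<^sub>1 :: "complex ^ 'n ^ 'n"
    and a :: 'm and b :: 'n
    and Q\<^sub>0 :: "'m cpoly" and Qhat\<^sub>1 :: "'n cpoly"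
    and f :: "'m \<Rightarrow> 'p::finite" and g :: "'n \<Rightarrow> 'p"
    and \<P> :: "(complex ^ 'p) set set" and \<S> :: "(complex ^ 1) set set"
    and \<D> :: "(complex ^ ('m + 'n)) set set" and \<E> :: "(complex ^ (1 + 'p)) set set"
  assumes "central_arrangement \<A>\<^sub>0" and "central_arrangement \<A>\<^sub>1"
    and "H\<^sub>0 \<in> \<A>\<^sub>0" and "H\<^sub>1 \<in> \<A>\<^sub>1"
    and "invertible T\<^sub>0" and "(\<lambda>v. T\<^sub>0 *v v) ` H\<^sub>0 = {x. x $ a = 0}"
    and "invertible T\<^sub>1" and "(\<lambda>v. T\<^sub>1 *v v) ` H\<^sub>1 = {y. y $ b = 0}"
    and "defining_polynomial ((\<lambda>H. (\<lambda>v. T\<^sub>0 *v v) ` H) ` \<A>\<^sub>0) Q\<^sub>0"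
    and "defining_polynomial ((\<lambda>H. (\<lambda>v. T\<^sub>1 *v v) ` H) ` \<A>\<^sub>1) (Var b * Qhat\<^sub>1)"
    and "glued_indices a b f g"
    and "defining_polynomial \<P> (rename_vars f Q\<^sub>0 * rename_vars g Qhat\<^sub>1)"
    and "defining_polynomial \<S> (Var 1)"
    and "is_direct_sum \<A>\<^sub>0 \<A>\<^sub>1 \<D>"
    and "is_direct_sum \<S> \<P> \<E>"
  shows "diffeomorphic (complement \<D>) (complement \<E>)"
proof -
  obtain B\<^sub>0 where B0: "T\<^sub>0 ** B\<^sub>0 = mat 1" "B\<^sub>0 ** T\<^sub>0 = mat 1"
    using assms(5) unfolding invertible_def by blast
  obtain B\<^sub>1 where B1: "T\<^sub>1 ** B\<^sub>1 = mat 1" "B\<^sub>1 ** T\<^sub>1 = mat 1"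
    using assms(7) unfolding invertible_def by blast
  have TB0 [simp]: "T\<^sub>0 *v (B\<^sub>0 *v v) = v" "B\<^sub>0 *v (T\<^sub>0 *v v) = v" for v
    by (simp_all add: matrix_vector_mul_assoc B0)
  have TB1 [simp]: "T\<^sub>1 *v (B\<^sub>1 *v v) = v" "B\<^sub>1 *v (T\<^sub>1 *v v) = v" for v
    by (simp_all add: matrix_vector_mul_assoc B1)
  have injT: "inj ((*v) T\<^sub>0)" "inj ((*v) T\<^sub>1)"
    by (metis injI TB0(2)) (metis injI TB1(2))
  have injf: "inj f" and injg: "inj g" and fg: "f a = g b"
    and int: "range f \<inter> range g = {f a}" and un: "range f \<union> range g = UNIV"
    using assms(11) unfolding glued_indices_def by auto

  \<comment> \<open>The complements in the chosen coordinates\<close>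
  have C0: "v \<in> complement \<A>\<^sub>0 \<longleftrightarrow> evaluate Q\<^sub>0 (T\<^sub>0 *v v) \<noteq> 0" for v
    using complement_image[OF injT(1), of v \<A>\<^sub>0] complement_eq_nonzero[OF assms(9)] by simp
  have C1: "v \<in> complement \<A>\<^sub>1 \<longleftrightarrow>
      (T\<^sub>1 *v v) $ b \<noteq> 0 \<and> evaluate Qhat\<^sub>1 (T\<^sub>1 *v v) \<noteq> 0" for v
    using complement_image[OF injT(2), of v \<A>\<^sub>1] complement_eq_nonzero[OF assms(10)]
    by (simp add: evaluate_mult)
  have Q0_a: "x $ a \<noteq> 0" if "evaluate Q\<^sub>0 x \<noteq> 0" for x
  proof -
    have "x \<notin> (\<lambda>v. T\<^sub>0 *v v) ` H\<^sub>0"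
      using that complement_eq_nonzero[OF assms(9)] assms(3) by (auto simp: complement_def)
    then show ?thesis
      unfolding assms(6) by simp
  qed
  \<comment> \<open>Centrality is given for \<open>\<A>\<^sub>1\<close>, not for its image under
    \<open>T\<^sub>1\<close>, so the scaling is done at \<open>B\<^sub>1 *v y\<close> and carried
    through \<open>T\<^sub>1\<close>.\<close>
  have scale: "c * y $ b \<noteq> 0 \<and> evaluate Qhat\<^sub>1 (c *s y) \<noteq> 0 \<longleftrightarrow> y $ b \<noteq> 0 \<and> evaluate Qhat\<^sub>1 y \<noteq> 0"
    if "c \<noteq> 0" for c y
    using central_complement_scale[OF assms(2) that, of "B\<^sub>1 *v y"]
    unfolding C1 by (simp add: matrix_vector_mult_scaleR vector_scalar_commute[symmetric])

  have D: "z \<in> complement \<D> \<longleftrightarrow> evaluate Q\<^sub>0 (T\<^sub>0 *v (\<chi> i. z $ Inl i)) \<noteq> 0 \<and>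
      (T\<^sub>1 *v (\<chi> j. z $ Inr j)) $ b \<noteq> 0 \<and> evaluate Qhat\<^sub>1 (T\<^sub>1 *v (\<chi> j. z $ Inr j)) \<noteq> 0" for z
    unfolding complement_direct_sum[OF assms(14)] C0 C1 ..
  have E: "w \<in> complement \<E> \<longleftrightarrow> w $ Inl 1 \<noteq> 0 \<and>
      evaluate Q\<^sub>0 (\<chi> i. w $ Inr (f i)) \<noteq> 0 \<and> evaluate Qhat\<^sub>1 (\<chi> j. w $ Inr (g j)) \<noteq> 0" for w
    unfolding complement_direct_sum[OF assms(15)] complement_eq_nonzero[OF assms(12)]
      complement_eq_nonzero[OF assms(13)]
    by (simp add: evaluate_mult evaluate_rename_vars)

  \<comment> \<open>The two maps and their coordinates\<close>
  define X where "X z = T\<^sub>0 *v (\<chi> i. z $ Inl i)" for z :: "complex ^ ('m + 'n)"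
  define Y where "Y z = T\<^sub>1 *v (\<chi> j. z $ Inr j)" for z :: "complex ^ ('m + 'n)"
  \<comment> \<open>An index outside \<open>range f\<close> lies in \<open>range g\<close>, so
    \<open>inv g\<close> is meaningful there; at the shared index the \<open>x\<close> value is
    taken.\<close>
  define F :: "complex ^ ('m + 'n) \<Rightarrow> complex ^ (1 + 'p)" where
    "F z = (\<chi> k. case k of Inl _ \<Rightarrow> Y z $ b
       | Inr k \<Rightarrow> if k \<in> range f then X z $ inv f k else X z $ a / Y z $ b * Y z $ inv g k)" for z
  \<comment> \<open>\<open>w $ Inr (f a)\<close> is the shared coordinate and
    \<open>w $ Inl 1\<close> the remembered \<open>y\<close> coordinate; \<open>B\<^sub>0\<close>
    and \<open>B\<^sub>1\<close> undo the coordinate changes.\<close>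
  define G :: "complex ^ (1 + 'p) \<Rightarrow> complex ^ ('m + 'n)" where
    "G w = (\<chi> k. case k of Inl i \<Rightarrow> (B\<^sub>0 *v (\<chi> i. w $ Inr (f i))) $ i
       | Inr j \<Rightarrow> w $ Inl 1 / w $ Inr (f a) * (B\<^sub>1 *v (\<chi> j. w $ Inr (g j))) $ j)" for w

  have F_s: "F z $ Inl i = Y z $ b" and F_f: "(\<chi> i. F z $ Inr (f i)) = X z" for z i
    using injf by (simp_all add: F_def vec_eq_iff)
  have F_g: "(\<chi> j. F z $ Inr (g j)) = (X z $ a / Y z $ b) *s Y z" if "Y z $ b \<noteq> 0" for z
  proof -
    have "F z $ Inr (g j) = X z $ a / Y z $ b * Y z $ j" for j
    \<comment> \<open>Only \<open>j = b\<close> meets \<open>range f\<close>, and there the rescaled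
      coordinate is \<open>X z $ a\<close>, the value \<open>F\<close> takes from
      \<open>x\<close>.\<close>
    proof (cases "g j \<in> range f")
      case True
      then have "g j = f a" using int by blast
      then have "j = b" using fg injg by (metis injD)
      then show ?thesis using that injf by (simp add: F_def flip: fg)
    next
      case False
      then show ?thesis using injg by (simp add: F_def)
    qed
    then show ?thesis by (simp add: vec_eq_iff)
  qed
  have X_G: "X (G w) = (\<chi> i. w $ Inr (f i))" for w
    by (simp add: X_def G_def)
  have Y_G: "Y (G w) = (w $ Inl 1 / w $ Inr (f a)) *s (\<chi> j. w $ Inr (g j))" for w
  proof -
    have "(\<chi> j. G w $ Inr j) = (w $ Inl 1 / w $ Inr (f a)) *s (B\<^sub>1 *v (\<chi> j. w $ Inr (g j)))"
      by (simp add: G_def vec_eq_iff)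
    then show ?thesis
      unfolding Y_def by (simp add: vector_scalar_commute[symmetric])
  qed

  \<comment> \<open>Nonvanishing denominators and smoothness\<close>
  have nzD: "X z $ a \<noteq> 0" "Y z $ b \<noteq> 0" if "z \<in> complement \<D>" for z
    using that Q0_a unfolding D X_def Y_def by blast+
  have nzE: "w $ Inl 1 \<noteq> 0" "w $ Inr (f a) \<noteq> 0" if "w \<in> complement \<E>" for w
    using that Q0_a[of "\<chi> i. w $ Inr (f i)"] unfolding E by auto

  have opens: "open (complement \<D>)" "open (complement \<E>)"
    using assms(14,15) by (auto intro: open_complement_direct_sum)
  have "smooth_on (complement \<D>) (\<lambda>z. X z $ i)" "smooth_on (complement \<D>) (\<lambda>z. Y z $ j)" for i j
    unfolding X_def Y_def by (rule smooth_on_matrix_nth)+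
  then have "smooth_on (complement \<D>) (\<lambda>z. case k of Inl _ \<Rightarrow> Y z $ b
       | Inr k \<Rightarrow> if k \<in> range f then X z $ inv f k else X z $ a / Y z $ b * Y z $ inv g k)"
    for k :: "1 + 'p"
    \<comment> \<open>The second split decides the \<open>if\<close> in the \<open>Inr\<close>
      branch.\<close>
    by (cases k; cases "projr k \<in> range f")
       (simp_all add: smooth_on_mult smooth_on_divide opens nzD)
  then have "smooth_on (complement \<D>) F"
    unfolding F_def by (intro smooth_on_vec_lambda opens)
  moreover have "smooth_on (complement \<E>) (\<lambda>w. case k of
        Inl i \<Rightarrow> (B\<^sub>0 *v (\<chi> i. w $ Inr (f i))) $ i
       | Inr j \<Rightarrow> w $ Inl 1 / w $ Inr (f a) * (B\<^sub>1 *v (\<chi> j. w $ Inr (g j))) $ j)" for k :: "'m + 'n"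
    by (cases k)
       (simp_all add: smooth_on_mult smooth_on_divide smooth_on_matrix_nth smooth_on_nth opens nzE)
  then have "smooth_on (complement \<E>) G"
    unfolding G_def by (intro smooth_on_vec_lambda opens)

  \<comment> \<open>The maps preserve the complements and are mutually inverse\<close>
  moreover have "F z \<in> complement \<E>" if "z \<in> complement \<D>" for z
    using that nzD[OF that] scale[of "X z $ a / Y z $ b" "Y z"]
    by (simp add: E F_s F_f F_g) (simp add: D X_def Y_def)
  moreover have "G w \<in> complement \<D>" if "w \<in> complement \<E>" for w
  proof -
    have "evaluate Q\<^sub>0 (X (G w)) \<noteq> 0 \<and> Y (G w) $ b \<noteq> 0 \<and> evaluate Qhat\<^sub>1 (Y (G w)) \<noteq> 0"
      using that nzE[OF that] scale[of "w $ Inl 1 / w $ Inr (f a)" "\<chi> j. w $ Inr (g j)"] fg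
      by (simp add: X_G Y_G E)
    then show ?thesis by (simp add: D X_def Y_def)
  qed
  moreover have "G (F z) = z" if "z \<in> complement \<D>" for z
  proof -
    \<comment> \<open>Hence \<open>G\<close> scales by \<open>Y z $ b / X z $ a\<close>, the
      reciprocal of the factor in \<open>F\<close>.\<close>
    have "F z $ Inr (f a) = X z $ a"
      using F_f[of z] by (simp add: vec_eq_iff)
    then have XY: "X (G (F z)) = X z" "Y (G (F z)) = Y z"
      using nzD[OF that] by (simp_all add: X_G Y_G F_s F_f F_g vector_smult_assoc)
    \<comment> \<open>Injectivity of \<open>T\<^sub>0\<close> and \<open>T\<^sub>1\<close> recovers
      the two blocks of \<open>z\<close> from \<open>X z\<close> and \<open>Y z\<close>.\<close>
    have "(\<chi> i. G (F z) $ Inl i) = (\<chi> i. z $ Inl i)" "(\<chi> j. G (F z) $ Inr j) = (\<chi> j. z $ Inr j)"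
      using XY injT unfolding X_def Y_def by (metis injD)+
    then have "G (F z) $ k = z $ k" for k
      by (cases k) (simp_all add: vec_eq_iff)
    then show ?thesis by (simp add: vec_eq_iff)
  qed
  moreover have "F (G w) = w" if "w \<in> complement \<E>" for w
  proof -
    have nz: "w $ Inr (f a) \<noteq> 0" "w $ Inl 1 \<noteq> 0" using nzE[OF that] by auto
    \<comment> \<open>As \<open>g b = f a\<close>, the denominator cancels against the
      \<open>b\<close>-th coordinate.\<close>
    have b: "Y (G w) $ b = w $ Inl 1"
      using nz fg by (simp add: Y_G)
    have f: "F (G w) $ Inr (f i) = w $ Inr (f i)" for i
      using F_f[of "G w"] by (simp add: vec_eq_iff X_G)
    have g: "F (G w) $ Inr (g j) = w $ Inr (g j)" for j
      using F_g[of "G w"] nz fg by (simp add: vec_eq_iff b) (simp add: X_G Y_G)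
    \<comment> \<open>The index type \<open>1\<close> has one element, and by \<open>un\<close>
      every other index comes from \<open>f\<close> or \<open>g\<close>.\<close>
    have "F (G w) $ k = w $ k" for k
    proof (cases k)
      case (Inl i)
      then show ?thesis by (metis F_s b num1_eq1)
    next
      case (Inr p)
      then show ?thesis using un f g by (metis UNIV_I Un_iff rangeE)
    qed
    then show ?thesis by (simp add: vec_eq_iff)
  qed
  ultimately show ?thesis
    unfolding diffeomorphic_def using opens by (intro conjI exI[of _ F] exI[of _ G]) auto
qed

end
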